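(* Let $T>0$, let $N\ge 1$ be an integer, put $\Delta t=T/N$ and $t_n=n\Delta t$ for $n=0,1,\dots,N$. Let $\lambda_0\in\mathbb{C}$ and $w_0=\lambda_0\,\Delta t$. Let $\theta>0$ be real and $c=\max\{1/\theta,\,2\}$. For $z_0,z_1,z_2\in\mathbb{C}$ write $w=z_0+z_1+z_2$, $p=(1-\theta z_1)(1-\theta z_2)$ and $$R(z_0,z_1,z_2,w_0)=1+\frac{w+w_0}{p}+\theta\,\frac{(z_0+w_0)(w+w_0)}{p^2}+\left(\tfrac12-\theta\right)\frac{(w+w_0)^2}{p^2}.$$ Consider the condition $$(\ast)\qquad |z_0|\le 2\sqrt{\Re z_1\,\Re z_2},\quad \Re z_1\le 0,\quad \Re z_2\le 0.$$ Then: (a) If $\theta\ge\tfrac13$, then $|R(z_0,z_1,z_2,w_0)^n|\le e^{c|\lambda_0|t_n}$ for all $n\in\{0,1,\dots,N\}$ whenever $z_0,z_1,z_2\in\mathbb{R}$ satisfy $(\ast)$. (b) If $\tfrac12\le\theta\le 1$, then $|R(z_0,z_1,z_2,w_0)^n|\le e^{c|\lambda_0|t_n}$ for all $n\in\{0,1,\dots,N\}$ whenever $z_0,z_1,z_2\in\mathbb{C}$ satisfy $(\ast)$.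
   Context: $\Re$ denotes the real part of a complex number. The function $R$ is the stability function of the one-step adaptation to partial integro-differential equations of the modified Craig--Sneyd (MCS) scheme: applying that scheme with parameter $\theta$ and step size $\Delta t$ to the scalar test equation $V'(t)=(\mu_0+\mu_1+\mu_2+\lambda_0)V(t)$ (with $\mu_0$ representing the mixed derivative term, $\mu_1,\mu_2$ the two spatial directions, and $\lambda_0$ the integral term) gives $V^n=R(z_0,z_1,z_2,w_0)V^{n-1}$ with $z_j=\mu_j\Delta t$ $(j=0,1,2)$ and $w_0=\lambda_0\Delta t$. *)

theory Defs
  imports "HOL-Analysis.Analysis"
begin

text \<open>
  Stability function of the modified Craig--Sneyd scheme with parameter \<open>\<theta>\<close>, adapted to the
  test equation \<open>V' = (\<mu>0 + \<mu>1 + \<mu>2 + \<lambda>0) V\<close>. The arguments \<open>z0\<close>, \<open>z1\<close>, \<open>z2\<close>, \<open>w0\<close> are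
  \<open>\<mu>0\<close>, \<open>\<mu>1\<close>, \<open>\<mu>2\<close>, \<open>\<lambda>0\<close> multiplied by the step size. If \<open>\<theta> > 0\<close>, \<open>Re z1 \<le> 0\<close> and
  \<open>Re z2 \<le> 0\<close>, then \<open>p \<noteq> 0\<close>, so the totalised division is harmless there.
\<close>

definition mcs_stability ::
    "real \<Rightarrow> complex \<Rightarrow> complex \<Rightarrow> complex \<Rightarrow> complex \<Rightarrow> complex" where
  "mcs_stability \<theta> z0 z1 z2 w0 =
    (let w = z0 + z1 + z2;
         p = (1 - complex_of_real \<theta> * z1) * (1 - complex_of_real \<theta> * z2)
     in 1 + (w + w0) / p
          + complex_of_real \<theta> * ((z0 + w0) * (w + w0) / p^2)
          + complex_of_real (1/2 - \<theta>) * ((w + w0)^2 / p^2))"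

definition mixed_derivative_condition :: "complex \<Rightarrow> complex \<Rightarrow> complex \<Rightarrow> bool" where
  "mixed_derivative_condition z0 z1 z2 \<longleftrightarrow>
    cmod z0 \<le> 2 * sqrt (Re z1 * Re z2) \<and> Re z1 \<le> 0 \<and> Re z2 \<le> 0"

end

theory Submission
  imports Defs
begin

text \<open>
  Put \<open>k = 1/\<theta>\<close> and \<open>p = (1 - \<theta> z1) (1 - \<theta> z2)\<close>. The idea is to replace \<open>z1\<close> and \<open>z2\<close> by their
  Cayley transforms \<open>(1 + \<theta> zj) / (1 - \<theta> zj)\<close>, which lie in the closed unit disc because
  \<open>Re zj \<le> 0\<close>. Only their product \<open>g\<close> matters: with \<open>e = 2 \<theta> z0 / p\<close> one finds
  \<open>w / p = - k h / 2\<close> for \<open>h = 1 - g - e\<close> and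
  \<open>R = 1 - k h (3 - g) / 4 + k\<^sup>2 h\<^sup>2 / 8 + L (w0 / p) + (w0 / p)\<^sup>2 / 2\<close> with
  \<open>L = (3 - k) / 2 + (k - 1) g / 2 + k e / 2\<close> (lemma \<open>mcs_stability_cayley\<close>).
  The condition on \<open>z0\<close>, \<open>z1\<close>, \<open>z2\<close> yields, by the Cauchy--Schwarz inequality in the plane, the
  single inequality \<open>|g| + |e| \<le> 1\<close> (lemma \<open>cayley_mixed_bound\<close>), and all that remains is to
  bound polynomials on the set it describes.

  For \<open>k \<le> 3\<close> one has \<open>|L| \<le> 2\<close>. The part free of \<open>w0\<close> has modulus at most 1. For real arguments
  and \<open>k \<le> 3\<close> this is elementary. For complex arguments and \<open>1 \<le> k \<le> 2\<close>, expand it in powers of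
  \<open>g\<close> and \<open>e\<close>. Only the coefficient of \<open>g\<^sup>2\<close> is negative, and lemma \<open>norm_quadratic_le\<close> shows that
  it does not spoil the estimate by the value at \<open>|g|\<close>, \<open>|e|\<close>. That value is at most the one at
  \<open>|g|\<close>, \<open>1 - |g|\<close>, where \<open>h = 0\<close> and the expression equals 1.

  Since \<open>|p| \<ge> 1\<close>, altogether \<open>|R| \<le> 1 + 2 |w0| + |w0|\<^sup>2 / 2 \<le> exp (2 |w0|)\<close>. Taking \<open>n\<close>-th
  powers and using \<open>c \<ge> 2\<close> gives the theorem.
\<close>

section \<open>The stability function in Cayley coordinates\<close>

lemma cauchy_schwarz_plane:
  fixes a b x y :: real
  shows "a * b + x * y \<le> sqrt (a\<^sup>2 + x\<^sup>2) * sqrt (b\<^sup>2 + y\<^sup>2)"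
proof -
  have "(a\<^sup>2 + x\<^sup>2) * (b\<^sup>2 + y\<^sup>2) - (a * b + x * y)\<^sup>2 = (a * y - x * b)\<^sup>2"
    by (simp add: power2_eq_square algebra_simps)
  then have "(a * b + x * y)\<^sup>2 \<le> (a\<^sup>2 + x\<^sup>2) * (b\<^sup>2 + y\<^sup>2)"
    by (metis diff_ge_0_iff_ge zero_le_power2)
  then show ?thesis
    by (metis real_le_rsqrt real_sqrt_mult)
qed

text \<open>
  Squared and divided by \<open>|1 - u|\<^sup>2\<close>, this says that the gap \<open>1 - |(1 + u) / (1 - u)|\<^sup>2\<close> left by
  the Cayley transform is \<open>- 4 Re u / |1 - u|\<^sup>2\<close>. It is the room available for the mixed derivative term.
\<close>

lemma cmod_one_minus_eq:
  fixes u :: complex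
  assumes "Re u \<le> 0"
  shows "cmod (1 - u) = sqrt ((cmod (1 + u))\<^sup>2 + (2 * sqrt (- Re u))\<^sup>2)"
proof -
  have "(cmod (1 - u))\<^sup>2 = (cmod (1 + u))\<^sup>2 + (2 * sqrt (- Re u))\<^sup>2"
    using assms
    by (simp add: cmod_power2 power_mult_distrib) (simp add: power2_eq_square algebra_simps)
  then show ?thesis
    by (metis norm_ge_zero real_sqrt_unique)
qed

lemma one_le_cmod_one_minus:
  fixes u :: complex
  assumes "Re u \<le> 0"
  shows "1 \<le> cmod (1 - u)"
  using assms complex_Re_le_cmod[of "1 - u"] by simp

text \<open>
  With \<open>u = \<theta> z1\<close>, \<open>v = \<theta> z2\<close>, \<open>\<zeta> = \<theta> z0\<close>, division by \<open>|(1 - u) (1 - v)|\<close> turns this into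
  \<open>|g| + |e| \<le> 1\<close>. The factor 2 in the hypothesis is exactly what makes Cauchy--Schwarz applicable
  to the vectors \<open>(|1 + u|, 2 sqrt (- Re u))\<close> and \<open>(|1 + v|, 2 sqrt (- Re v))\<close>.
\<close>

lemma cayley_mixed_bound:
  fixes u v \<zeta> :: complex
  assumes "Re u \<le> 0" "Re v \<le> 0" "cmod \<zeta> \<le> 2 * sqrt (Re u * Re v)"
  shows "cmod ((1 + u) * (1 + v)) + cmod (2 * \<zeta>) \<le> cmod ((1 - u) * (1 - v))"
proof -
  have "sqrt (Re u * Re v) = sqrt (- Re u) * sqrt (- Re v)"
    by (simp flip: real_sqrt_mult)
  then have "cmod (2 * \<zeta>) \<le> (2 * sqrt (- Re u)) * (2 * sqrt (- Re v))"
    using assms(3) by (simp add: norm_mult)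
  moreover have "cmod (1 + u) * cmod (1 + v) + (2 * sqrt (- Re u)) * (2 * sqrt (- Re v))
      \<le> cmod (1 - u) * cmod (1 - v)"
    unfolding cmod_one_minus_eq[OF assms(1)] cmod_one_minus_eq[OF assms(2)]
    by (rule cauchy_schwarz_plane)
  ultimately show ?thesis
    unfolding norm_mult[of "1 + u"] norm_mult[of "1 - u"] by linarith
qed

text \<open>
  All occurrences of \<open>z1\<close> and \<open>z2\<close> outside \<open>p\<close> are absorbed by \<open>\<theta> (z1 + z2) / p = - (1 - g) / 2\<close>,
  which reduces the two directions to the single variable \<open>g\<close>.
\<close>

lemma mcs_stability_cayley:
  fixes z0 z1 z2 w0 :: complex and \<theta> :: real
  defines "p \<equiv> (1 - of_real \<theta> * z1) * (1 - of_real \<theta> * z2)"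
  defines "g \<equiv> (1 + of_real \<theta> * z1) * (1 + of_real \<theta> * z2) / p"
    and "e \<equiv> 2 * (of_real \<theta> * z0) / p"
    and "k \<equiv> of_real (1 / \<theta>)"
  assumes "\<theta> > 0" "p \<noteq> 0"
  shows "mcs_stability \<theta> z0 z1 z2 w0 =
      (1 - k * (1 - g - e) * (3 - g) / 4 + k\<^sup>2 * (1 - g - e)\<^sup>2 / 8)
      + ((3 - k) / 2 + (k - 1) / 2 * g + k / 2 * e) * (w0 / p) + (w0 / p)\<^sup>2 / 2"
proof -
  define t where "t = complex_of_real \<theta>"
  have t: "t \<noteq> 0" "k * t = 1" using \<open>\<theta> > 0\<close> by (auto simp: t_def k_def)
  define a where "a = z0 / p"
  define s where "s = (z1 + z2) / p"
  define x where "x = w0 / p"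
  have p: "p = (1 - t * z1) * (1 - t * z2)" by (simp add: p_def t_def)
  have e: "e = 2 * t * a" by (simp add: e_def a_def t_def)
  have "g * p = p + 2 * t * (z1 + z2)"
  proof -
    have "g * p = (1 + t * z1) * (1 + t * z2)" using \<open>p \<noteq> 0\<close> by (simp add: g_def t_def)
    then show ?thesis by (simp add: p algebra_simps)
  qed
  then have g: "g = 1 + 2 * t * s"
    using \<open>p \<noteq> 0\<close> by (simp add: s_def field_simps)
  have coeff: "complex_of_real (1/2 - \<theta>) = 1/2 - t" by (simp add: t_def)
  have "mcs_stability \<theta> z0 z1 z2 w0 = 1 + (a + s + x) + t * ((a + x) * (a + s + x))
      + (1/2 - t) * (a + s + x)\<^sup>2"
  proof -
    have sums: "a + s + x = (z0 + z1 + z2 + w0) / p" "a + x = (z0 + w0) / p"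
      by (simp_all add: a_def s_def x_def add_divide_distrib)
    show ?thesis
      unfolding mcs_stability_def Let_def coeff t_def[symmetric] p[symmetric] sums
      by (simp add: power2_eq_square)
  qed
  also have "\<dots> = (1 - k * (1 - g - e) * (3 - g) / 4 + k\<^sup>2 * (1 - g - e)\<^sup>2 / 8)
      + ((3 - k) / 2 + (k - 1) / 2 * g + k / 2 * e) * x + x\<^sup>2 / 2"
  proof -
    have h: "k * (1 - g - e) = - 2 * (a + s)"
      using t(2) unfolding g e by algebra
    have L: "(3 - k) / 2 + (k - 1) / 2 * g + k / 2 * e = 1 + a + s - t * s"
    proof -
      have "(3 - k) / 2 + (k - 1) / 2 * g + k / 2 * e = 1 + (k * t) * (a + s) - t * s"
        unfolding g e by (simp add: field_simps)
      then show ?thesis by (simp add: t(2))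
    qed
    have "1 - k * (1 - g - e) * (3 - g) / 4 + k\<^sup>2 * (1 - g - e)\<^sup>2 / 8
        = 1 + (a + s) * (1 - t * s) + (a + s)\<^sup>2 / 2"
      unfolding power_mult_distrib[symmetric] h unfolding g
      by (simp add: field_simps power2_eq_square)
    then show ?thesis
      unfolding L by (simp add: field_simps power2_eq_square)
  qed
  finally show ?thesis by (simp add: x_def)
qed

section \<open>Polynomial bounds on the set where \<open>|g| + |e| \<le> 1\<close>\<close>

text \<open>
  On the circle \<open>|z| = r\<close> the squared modulus of the left-hand side is a concave quadratic polynomial
  in \<open>Re z\<close>, since \<open>c0 c2 \<le> 0\<close>. The last hypothesis makes its derivative at \<open>Re z = r\<close>
  nonnegative for \<open>r = 1\<close>, hence for all \<open>r \<le> 1\<close>, so that the maximum is attained at \<open>z = r\<close>.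
\<close>

lemma norm_quadratic_le:
  fixes c0 c1 c2 :: real and z :: complex
  assumes "0 \<le> c0" "0 \<le> c1" "c2 \<le> 0" "0 \<le> c0 + c2" "cmod z \<le> 1"
    and slope: "0 \<le> c1 * (c0 + c2) + 4 * c0 * c2"
  shows "cmod (of_real c0 + of_real c1 * z + of_real c2 * z\<^sup>2)
      \<le> c0 + c1 * cmod z + c2 * (cmod z)\<^sup>2"
proof -
  define r where "r = cmod z"
  define x where "x = Re z"
  define y where "y = Im z"
  have r: "0 \<le> r" "r \<le> 1" "r\<^sup>2 \<le> 1"
    using assms(5) by (auto simp: r_def power_le_one)
  have rr: "r\<^sup>2 = x\<^sup>2 + y\<^sup>2" by (simp add: r_def x_def y_def cmod_power2)
  have xr: "x \<le> r" by (simp add: x_def r_def complex_Re_le_cmod)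
  have c2r: "c2 \<le> c2 * r\<^sup>2"
    using assms(3) r by (simp add: mult_le_cancel_left1)
  have "0 \<le> c0 + c1 * r + c2 * r\<^sup>2"
    using c2r assms(2,4) r(1) mult_nonneg_nonneg[of c1 r] by linarith
  moreover have "(cmod (of_real c0 + of_real c1 * z + of_real c2 * z\<^sup>2))\<^sup>2
      \<le> (c0 + c1 * r + c2 * r\<^sup>2)\<^sup>2"
  proof -
    have "(cmod (of_real c0 + of_real c1 * z + of_real c2 * z\<^sup>2))\<^sup>2
        = (c0 + c1 * x + c2 * (x\<^sup>2 - y\<^sup>2))\<^sup>2 + (c1 * y + c2 * (2 * x * y))\<^sup>2"
      unfolding cmod_power2 by (simp add: x_def y_def power2_eq_square algebra_simps)
    also have "\<dots> = (c0 + c1 * r + c2 * r\<^sup>2)\<^sup>2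
        - 2 * (r - x) * (c1 * (c0 + c2 * r\<^sup>2) + 2 * (c0 * c2) * (r + x))"
    proof -
      have y: "y\<^sup>2 = r\<^sup>2 - x\<^sup>2" using rr by simp
      have "(c1 * y + c2 * (2 * x * y))\<^sup>2 = (c1 + 2 * c2 * x)\<^sup>2 * y\<^sup>2"
        by (simp add: power2_eq_square algebra_simps)
      then show ?thesis
        unfolding y by (simp add: power2_eq_square algebra_simps)
    qed
    also have "\<dots> \<le> (c0 + c1 * r + c2 * r\<^sup>2)\<^sup>2"
    proof -
      have "c1 * (c0 + c2) \<le> c1 * (c0 + c2 * r\<^sup>2)"
        using c2r assms(2) by (intro mult_left_mono) auto
      moreover have "2 * (c0 * c2) * 2 \<le> 2 * (c0 * c2) * (r + x)"
        using xr r assms(1,3) by (intro mult_left_mono_neg) (auto simp: mult_nonneg_nonpos)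
      ultimately have "0 \<le> c1 * (c0 + c2 * r\<^sup>2) + 2 * (c0 * c2) * (r + x)"
        using slope by linarith
      then show ?thesis using xr by (simp add: mult_nonneg_nonneg)
    qed
    finally show ?thesis .
  qed
  ultimately show ?thesis unfolding r_def by (rule power2_le_imp_le[rotated])
qed

text \<open>
  The coefficients below are those of the expansion in powers of \<open>g\<close> and \<open>e\<close>. For them the slope
  expression of \<open>norm_quadratic_le\<close> vanishes identically in \<open>k\<close>.
\<close>

lemma homogeneous_part_bound_complex:
  fixes g e :: complex and k :: real
  assumes "1 \<le> k" "k \<le> 2" "cmod g + cmod e \<le> 1"
  shows "cmod (1 - of_real k * (1 - g - e) * (3 - g) / 4
      + (of_real k)\<^sup>2 * (1 - g - e)\<^sup>2 / 8) \<le> 1"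
proof -
  \<comment> \<open>The coefficients of \<open>1, g, g\<^sup>2, e, g e, e\<^sup>2\<close>.\<close>
  define c0 where "c0 = (2 - k) * (4 - k) / 8"
  define c1 where "c1 = k * (4 - k) / 4"
  define c2 where "c2 = - (k * (2 - k) / 8)"
  define d1 where "d1 = k * (3 - k) / 4"
  define d2 where "d2 = k * (k - 1) / 4"
  define d3 where "d3 = k\<^sup>2 / 8"
  define r where "r = cmod g"
  define q where "q = cmod e"
  have sgn: "0 \<le> c0" "0 \<le> c1" "c2 \<le> 0" "0 \<le> d1" "0 \<le> d2" "0 \<le> d3"
    using assms(1,2) by (auto simp: c0_def c1_def c2_def d1_def d2_def d3_def)
  have rq: "0 \<le> r" "0 \<le> q" "r \<le> 1" "q \<le> 1 - r"
    using assms(3) by (auto simp: r_def q_def intro: order_trans[of _ "cmod g + cmod e"])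
  have sum02: "c0 + c2 = (2 - k)\<^sup>2 / 4"
    by (simp add: c0_def c2_def field_simps power2_eq_square)
  have slope: "c1 * (c0 + c2) + 4 * c0 * c2 = 0"
    unfolding sum02 by (simp add: c0_def c1_def c2_def field_simps power2_eq_square)
  have "1 - of_real k * (1 - g - e) * (3 - g) / 4 + (of_real k)\<^sup>2 * (1 - g - e)\<^sup>2 / 8
      = (of_real c0 + of_real c1 * g + of_real c2 * g\<^sup>2)
        + (of_real d1 * e + of_real d2 * (g * e) + of_real d3 * e\<^sup>2)"
    by (simp add: c0_def c1_def c2_def d1_def d2_def d3_def field_simps power2_eq_square)
  also have "cmod \<dots> \<le> cmod (of_real c0 + of_real c1 * g + of_real c2 * g\<^sup>2)
      + (cmod (of_real d1 * e) + cmod (of_real d2 * (g * e)) + cmod (of_real d3 * e\<^sup>2))"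
    by (intro norm_triangle_le add_mono order_refl)
  also have "\<dots> \<le> (c0 + c1 * r + c2 * r\<^sup>2) + (d1 * q + d2 * (r * q) + d3 * q\<^sup>2)"
  proof (intro add_mono)
    show "cmod (of_real c0 + of_real c1 * g + of_real c2 * g\<^sup>2) \<le> c0 + c1 * r + c2 * r\<^sup>2"
      using norm_quadratic_le[of c0 c1 c2 g] sgn slope sum02 rq by (simp add: r_def)
  qed (use sgn in \<open>simp_all add: norm_mult norm_power r_def q_def\<close>)
  also have "\<dots> \<le> (c0 + c1 * r + c2 * r\<^sup>2)
      + (d1 * (1 - r) + d2 * (r * (1 - r)) + d3 * (1 - r)\<^sup>2)"
    using sgn rq by (intro add_mono mult_left_mono power_mono order_refl) auto
  \<comment> \<open>At \<open>g = r\<close> and \<open>e = 1 - r\<close> the factor \<open>1 - g - e\<close> vanishes.\<close>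
  also have "\<dots> = 1"
    by (simp add: c0_def c1_def c2_def d1_def d2_def d3_def field_simps power2_eq_square)
  finally show ?thesis .
qed

text \<open>
  The lower bound holds because \<open>2 - (k h) (3 - g) / 4 + (k h)\<^sup>2 / 8\<close> is a quadratic polynomial in \<open>k h\<close>
  whose discriminant \<open>((3 - g)\<^sup>2 - 16) / 16\<close> is nonpositive for \<open>-1 \<le> g \<le> 1\<close>.
\<close>

lemma homogeneous_part_bound_real:
  fixes g e k :: real
  assumes "0 \<le> k" "k \<le> 3" "\<bar>g\<bar> + \<bar>e\<bar> \<le> 1"
  shows "\<bar>1 - k * (1 - g - e) * (3 - g) / 4 + k\<^sup>2 * (1 - g - e)\<^sup>2 / 8\<bar> \<le> 1"
proof -
  define x where "x = k * (1 - g - e)"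
  have h: "0 \<le> 1 - g - e" using assms(3) by linarith
  then have x0: "0 \<le> x" using assms(1) by (simp add: x_def)
  have "x \<le> 3 * (1 - g - e)" unfolding x_def using h assms(2) by (rule mult_right_mono[rotated])
  also have "\<dots> \<le> 2 * (3 - g)" using assms(3) by (simp add: abs_if split: if_splits)
  finally have "x * x \<le> x * (2 * (3 - g))" using x0 by (intro mult_left_mono)
  then have upper: "1 - x * (3 - g) / 4 + x\<^sup>2 / 8 \<le> 1"
    by (simp add: power2_eq_square algebra_simps)
  have "(3 - g)\<^sup>2 \<le> 4\<^sup>2" using assms(3) by (intro power_mono) auto
  moreover have "2 - x * (3 - g) / 4 + x\<^sup>2 / 8 = (x - (3 - g))\<^sup>2 / 8 + (4\<^sup>2 - (3 - g)\<^sup>2) / 8"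
    by (simp add: field_simps power2_eq_square)
  ultimately have lower: "0 \<le> 2 - x * (3 - g) / 4 + x\<^sup>2 / 8"
    by simp
  have "k\<^sup>2 * (1 - g - e)\<^sup>2 = x\<^sup>2" by (simp add: x_def power_mult_distrib)
  with upper lower show ?thesis unfolding x_def[symmetric] by (simp add: x_def abs_le_iff)
qed

lemma linear_coefficient_bound:
  fixes g e :: complex and k :: real
  assumes "0 \<le> k" "k \<le> 3" "cmod g + cmod e \<le> 1"
  shows "cmod ((3 - of_real k) / 2 + (of_real k - 1) / 2 * g + of_real k / 2 * e) \<le> 2"
proof -
  define r where "r = cmod g"
  have r: "0 \<le> r" "r \<le> 1" "cmod e \<le> 1 - r"
    using assms(3) norm_ge_zero[of g] norm_ge_zero[of e] unfolding r_def by linarith+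
  have "(3 - of_real k) / 2 + (of_real k - 1) / 2 * g + of_real k / 2 * e
      = of_real ((3 - k) / 2) + of_real ((k - 1) / 2) * g + of_real (k / 2) * e"
    by simp
  also have "cmod \<dots> \<le> cmod (of_real ((3 - k) / 2)) + cmod (of_real ((k - 1) / 2) * g)
      + cmod (of_real (k / 2) * e)"
    by (intro norm_triangle_le add_mono order_refl)
  also have "\<dots> = (3 - k) / 2 + \<bar>(k - 1) / 2\<bar> * r + k / 2 * cmod e"
    using assms(1,2) by (simp only: norm_mult norm_of_real r_def) simp
  also have "\<dots> \<le> (3 - k) / 2 + \<bar>(k - 1) / 2\<bar> * r + k / 2 * (1 - r)"
    using r assms(1) by (intro add_mono mult_left_mono order_refl) auto
  also have "\<dots> \<le> 2"
  proof -
    have "\<bar>(k - 1) / 2\<bar> * r \<le> (1 + k) / 2 * r"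
      using r assms(1) by (intro mult_right_mono) auto
    then show ?thesis using r by (simp add: field_simps)
  qed
  finally show ?thesis .
qed

section \<open>Stability\<close>

text \<open>
  The two regimes of the last hypothesis are told apart only in the bound for the part free of \<open>w0\<close>.
\<close>

lemma cmod_mcs_stability_le_exp:
  fixes z0 z1 z2 w0 :: complex and \<theta> :: real
  assumes \<theta>: "1/3 \<le> \<theta>" and cond: "mixed_derivative_condition z0 z1 z2"
    and cases: "(z0 \<in> \<real> \<and> z1 \<in> \<real> \<and> z2 \<in> \<real>) \<or> (1/2 \<le> \<theta> \<and> \<theta> \<le> 1)"
  shows "cmod (mcs_stability \<theta> z0 z1 z2 w0) \<le> exp (2 * cmod w0)"
proof -
  define p where "p = (1 - of_real \<theta> * z1) * (1 - of_real \<theta> * z2)"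
  define g where "g = (1 + of_real \<theta> * z1) * (1 + of_real \<theta> * z2) / p"
  define e where "e = 2 * (of_real \<theta> * z0) / p"
  define k where "k = 1 / \<theta>"
  define H where "H = 1 - of_real k * (1 - g - e) * (3 - g) / 4
      + (of_real k)\<^sup>2 * (1 - g - e)\<^sup>2 / 8"
  define L where "L = (3 - of_real k) / 2 + (of_real k - 1) / 2 * g + of_real k / 2 * e"
  have pos: "\<theta> > 0" using \<theta> by simp
  have k: "0 \<le> k" "k \<le> 3" using \<theta> by (auto simp: k_def field_simps)
  have z: "cmod z0 \<le> 2 * sqrt (Re z1 * Re z2)" "Re z1 \<le> 0" "Re z2 \<le> 0"
    using cond by (auto simp: mixed_derivative_condition_def)
  have re: "Re (of_real \<theta> * z1) \<le> 0" "Re (of_real \<theta> * z2) \<le> 0"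
    using z(2,3) pos by (auto simp: mult_nonneg_nonpos)
  have p1: "1 \<le> cmod p"
    using mult_mono[OF one_le_cmod_one_minus[OF re(1)] one_le_cmod_one_minus[OF re(2)]]
    by (simp add: p_def norm_mult)
  then have p0: "p \<noteq> 0" by auto
  have "cmod (of_real \<theta> * z0) \<le> 2 * sqrt (Re (of_real \<theta> * z1) * Re (of_real \<theta> * z2))"
  proof -
    have "sqrt (Re (of_real \<theta> * z1) * Re (of_real \<theta> * z2)) = sqrt (\<theta>\<^sup>2 * (Re z1 * Re z2))"
      by (simp add: power2_eq_square mult_ac)
    also have "\<dots> = \<theta> * sqrt (Re z1 * Re z2)" using pos by (simp add: real_sqrt_mult)
    finally show ?thesis using z(1) pos by (simp add: norm_mult)
  qed
  from cayley_mixed_bound[OF re this]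
  have ge: "cmod g + cmod e \<le> 1"
    using p1 p0 unfolding g_def e_def p_def[symmetric]
    by (simp add: norm_divide add_divide_distrib[symmetric])
  have H: "cmod H \<le> 1"
    using cases
  proof
    assume "z0 \<in> \<real> \<and> z1 \<in> \<real> \<and> z2 \<in> \<real>"
    then have "g \<in> \<real>" "e \<in> \<real>" by (auto simp: g_def e_def p_def)
    then obtain g' e' where ge': "g = of_real g'" "e = of_real e'" by (auto elim!: Reals_cases)
    have "H = of_real (1 - k * (1 - g' - e') * (3 - g') / 4 + k\<^sup>2 * (1 - g' - e')\<^sup>2 / 8)"
      by (simp add: H_def ge')
    then show ?thesis
      using homogeneous_part_bound_real[OF k] ge by (simp only: norm_of_real ge')
  next
    assume "1/2 \<le> \<theta> \<and> \<theta> \<le> 1"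
    then have "1 \<le> k" "k \<le> 2" by (auto simp: k_def field_simps)
    then show ?thesis unfolding H_def using ge by (rule homogeneous_part_bound_complex)
  qed
  have L: "cmod L \<le> 2" unfolding L_def by (rule linear_coefficient_bound[OF k ge])
  have x: "cmod (w0 / p) \<le> cmod w0"
    using p1 p0 by (simp add: norm_divide divide_le_eq mult_le_cancel_left1)
  have "mcs_stability \<theta> z0 z1 z2 w0 = H + L * (w0 / p) + (w0 / p)\<^sup>2 / 2"
    using mcs_stability_cayley[OF pos, of z1 z2 z0 w0] p0
    unfolding H_def L_def g_def e_def k_def p_def by blast
  also have "cmod \<dots> \<le> cmod H + cmod L * cmod (w0 / p) + (cmod (w0 / p))\<^sup>2 / 2"
    by (intro norm_triangle_le add_mono) (simp_all add: norm_mult norm_divide norm_power)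
  also have "\<dots> \<le> 1 + 2 * cmod w0 + (cmod w0)\<^sup>2 / 2"
    using H L x by (intro add_mono mult_mono divide_right_mono power_mono) auto
  also have "\<dots> \<le> 1 + 2 * cmod w0 + (2 * cmod w0)\<^sup>2 / 2"
    by (simp add: power_mult_distrib)
  also have "\<dots> \<le> exp (2 * cmod w0)"
    by (intro exp_lower_Taylor_quadratic) simp
  finally show ?thesis .
qed

theorem theorem3:
  fixes T dt \<theta> c :: real and N :: nat and t :: "nat \<Rightarrow> real" and lam0 w0 :: complex
  assumes "T > 0" and "N \<ge> 1"
    and "dt = T / real N"
    and "\<And>n. n \<le> N \<Longrightarrow> t n = real n * dt"
    and "w0 = lam0 * complex_of_real dt"
    and "\<theta> > 0"
    and "c = max (1 / \<theta>) 2"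
  shows "(\<theta> \<ge> 1/3 \<longrightarrow>
            (\<forall>z0 z1 z2 :: complex. z0 \<in> \<real> \<longrightarrow> z1 \<in> \<real> \<longrightarrow> z2 \<in> \<real> \<longrightarrow>
               mixed_derivative_condition z0 z1 z2 \<longrightarrow>
               (\<forall>n \<le> N. cmod (mcs_stability \<theta> z0 z1 z2 w0 ^ n) \<le> exp (c * cmod lam0 * t n)))) \<and>
         (1/2 \<le> \<theta> \<and> \<theta> \<le> 1 \<longrightarrow>
            (\<forall>z0 z1 z2 :: complex.
               mixed_derivative_condition z0 z1 z2 \<longrightarrow>
               (\<forall>n \<le> N. cmod (mcs_stability \<theta> z0 z1 z2 w0 ^ n) \<le> exp (c * cmod lam0 * t n))))"
proof -
  have dt: "0 \<le> dt" using assms(1,3) by simp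
  have w0: "cmod w0 = cmod lam0 * dt" using dt assms(5) by (simp add: norm_mult)
  have power_bound: "cmod (mcs_stability \<theta> z0 z1 z2 w0 ^ n) \<le> exp (c * cmod lam0 * t n)"
    if "cmod (mcs_stability \<theta> z0 z1 z2 w0) \<le> exp (2 * cmod w0)" "n \<le> N" for z0 z1 z2 n
  proof -
    have "cmod (mcs_stability \<theta> z0 z1 z2 w0 ^ n) \<le> exp (2 * cmod w0) ^ n"
      unfolding norm_power using that(1) by (intro power_mono) auto
    also have "\<dots> = exp (2 * (cmod lam0 * t n))"
      using assms(4)[OF that(2)] by (simp add: w0 exp_of_nat_mult[symmetric] mult_ac)
    also have "\<dots> \<le> exp (c * (cmod lam0 * t n))"
      using assms(4)[OF that(2)] assms(7) dt by (auto intro!: mult_right_mono)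
    finally show ?thesis by (simp add: mult.assoc)
  qed
  show ?thesis
    by (intro conjI allI impI power_bound cmod_mcs_stability_le_exp) auto
qed

end
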